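(* For every $X\subseteq{}^{\omega}2$ the following conditions are equivalent: (a) $X$ is meager-additive. (b) For every sequence $n_0<n_1<n_2<\dots$ of natural numbers there are a sequence $i_0<i_1<\dots$ of natural numbers and a $y\in{}^{\omega}2$ such that for every $x\in X$ and for every sufficiently big $k<\omega$ there is an $l\in[i_k,i_{k+1})$ such that $x\restriction[n_l,n_{l+1})=y\restriction[n_l,n_{l+1})$.
   Context: ${}^{\omega}2$ is the Cantor space of infinite $0$-$1$ sequences with its usual topology and componentwise addition modulo 2; for $A,B\subseteq{}^\omega2$, $A+B=\{a+b:a\in A,b\in B\}$. $X\subseteq{}^{\omega}2$ is meager-additive if $X+A$ is meager for every meager $A\subseteq{}^{\omega}2$. Intervals $[i,j)$ are intervals of natural numbers. How big $k$ must be in (b) may depend on $x$. *)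

theory Defs
  imports "HOL-Analysis.Analysis" "HOL-Library.Function_Algebras" "HOL-Library.Z2"
begin

text \<open>
  The two-element field \<^typ>\<open>bit\<close> carries no topology in the library.  With the discrete
  topology on it, \<^typ>\<open>nat \<Rightarrow> bit\<close> with the library's product topology, pointwise addition
  and elementwise addition of sets is the Cantor group.
\<close>

instantiation bit :: discrete_topology
begin

definition open_bit :: "bit set \<Rightarrow> bool"
  where "open_bit S \<longleftrightarrow> True"

instance
  by standard (simp_all add: open_bit_def)

end

type_synonym cantor = "nat \<Rightarrow> bit"

definition nowhere_dense :: "'a::topological_space set \<Rightarrow> bool"
  where "nowhere_dense A \<longleftrightarrow> interior (closure A) = {}"

definition meager :: "'a::topological_space set \<Rightarrow> bool"
  where "meager A \<longleftrightarrow> (\<exists>F. countable F \<and> (\<forall>N\<in>F. nowhere_dense N) \<and> A = \<Union>F)"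

definition meager_additive :: "cantor set \<Rightarrow> bool"
  where "meager_additive X \<longleftrightarrow> (\<forall>A. meager A \<longrightarrow> meager (X + A))"

end

theory Submission
  imports Defs
begin

text \<open>
  Cut the natural numbers into consecutive blocks and fix a point \<open>z\<close>.  The points that disagree
  with \<open>z\<close> somewhere on almost every block form a meager set, and these sets are cofinal among the
  meager sets, even if the blocks have to be unions of blocks of a partition given in advance
  (\<open>meager_avoiding\<close> and \<open>meager_subset_avoiding\<close>).  Both implications are then computations with
  such sets.

  If \<open>X\<close> satisfies the combinatorial condition and \<open>A\<close> is meager, take the blocks and the point
  \<open>z\<close> for \<open>A\<close>, and then \<open>i\<close> and \<open>y\<close> for these blocks.  Where \<open>x \<in> X\<close> agrees with \<open>y\<close> on a block
  on which \<open>a \<in> A\<close> disagrees with \<open>z\<close>, the sum \<open>x + a\<close> disagrees with \<open>y + z\<close>; so \<open>x + a\<close>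
  disagrees with \<open>y + z\<close> on almost every union of blocks given by \<open>i\<close>.

  Conversely, given blocks, let \<open>A\<close> be the set of points that are not constantly \<open>0\<close> on almost
  every block.  As \<open>X + A\<close> is meager, all its elements disagree with some \<open>z\<close> on almost all blocks
  of a coarser partition.  If some \<open>x \<in> X\<close> agreed with \<open>z\<close> on none of the small blocks inside
  infinitely many coarse ones, then \<open>z - x\<close> on these coarse blocks, continued by \<open>1\<close>, would be in
  \<open>A\<close>, although its sum with \<open>x\<close> is equal to \<open>z\<close> on infinitely many coarse blocks.  Hence \<open>z\<close>
  is the required \<open>y\<close>.
\<close>

section \<open>Cylinders of the Cantor space\<close>

lemma open_cylinder: "open {x :: cantor. \<forall>j\<in>{p..<q}. x j = u j}"
proof -
  have "open ((\<lambda>x :: cantor. x j) -` {u j})" for j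
    by (intro open_vimage open_discrete continuous_on_product_coordinates)
  then have "open {x :: cantor. x j = u j}" for j
    by (simp add: vimage_def)
  then have "open (\<Inter>j\<in>{p..<q}. {x :: cantor. x j = u j})"
    by (intro open_INT) auto
  moreover have "(\<Inter>j\<in>{p..<q}. {x :: cantor. x j = u j}) = {x. \<forall>j\<in>{p..<q}. x j = u j}"
    by auto
  ultimately show ?thesis by simp
qed

lemma open_contains_cylinder:
  fixes U :: "cantor set"
  assumes "open U" "u \<in> U"
  obtains q where "\<And>x. (\<And>j. j < q \<Longrightarrow> x j = u j) \<Longrightarrow> x \<in> U"
proof -
  obtain B where B: "u \<in> Pi\<^sub>E UNIV B" "finite {j. B j \<noteq> UNIV}" "Pi\<^sub>E UNIV B \<subseteq> U"
    using product_topology_open_contains_basis[of "\<lambda>_. euclidean" UNIV U u] assms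
    by (auto simp: open_fun_def)
  obtain q where q: "\<And>j. B j \<noteq> UNIV \<Longrightarrow> j < q"
    using B(2) unfolding finite_nat_set_iff_bounded by auto
  have "x \<in> U" if x: "\<And>j. j < q \<Longrightarrow> x j = u j" for x
  proof -
    have "x j \<in> B j" for j
      using q[of j] x[of j] B(1) by (cases "B j = UNIV") auto
    then show ?thesis using B(3) by auto
  qed
  then show thesis using that by blast
qed

section \<open>Meager sets as sets of points avoiding a pattern\<close>

lemma meager_subset:
  assumes "meager B" "A \<subseteq> B"
  shows "meager A"
proof -
  obtain F where F: "countable F" "\<forall>N\<in>F. nowhere_dense N" "B = \<Union>F"
    using assms(1) unfolding meager_def by blast
  have "nowhere_dense (N \<inter> A)" if "nowhere_dense N" for N
    using that interior_mono[OF closure_mono[of "N \<inter> A" N]]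
    unfolding nowhere_dense_def by auto
  then show ?thesis
    using F assms(2) unfolding meager_def
    by (intro exI[of _ "(\<lambda>N. N \<inter> A) ` F"]) auto
qed

definition avoiding :: "(nat \<Rightarrow> nat) \<Rightarrow> cantor \<Rightarrow> cantor set" where
  "avoiding n z = {x. \<forall>\<^sub>F k in sequentially. \<exists>j\<in>{n k..<n (Suc k)}. x j \<noteq> z j}"

text \<open>
  Avoiding \<open>z\<close> on every block from some block onwards is a closed condition, and no finite
  initial segment enforces it, since every such segment can be continued by \<open>z\<close>.
\<close>

lemma meager_avoiding:
  assumes n: "strict_mono n"
  shows "meager (avoiding n z)"
proof -
  define E where "E m = {x. \<forall>k\<ge>m. \<exists>j\<in>{n k..<n (Suc k)}. x j \<noteq> z j}" for m
  have "nowhere_dense (E m)" for m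
  proof -
    have "- E m = (\<Union>k\<in>{m..}. {x. \<forall>j\<in>{n k..<n (Suc k)}. x j = z j})"
      unfolding E_def by auto
    then have "closed (E m)"
      unfolding closed_def using open_cylinder by auto
    moreover have "interior (E m) = {}"
    proof (rule ccontr)
      assume "interior (E m) \<noteq> {}"
      then obtain u where "u \<in> interior (E m)" by blast
      then obtain q where q: "\<And>x. (\<And>j. j < q \<Longrightarrow> x j = u j) \<Longrightarrow> x \<in> interior (E m)"
        using open_contains_cylinder[OF open_interior] by blast
      define k where "k = max m q"
      define v where "v j = (if j < q then u j else z j)" for j
      have "v \<in> E m"
        using q[of v] interior_subset by (auto simp: v_def)
      moreover have "k \<ge> m" by (simp add: k_def)
      ultimately have "\<exists>j\<in>{n k..<n (Suc k)}. v j \<noteq> z j"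
        unfolding E_def by blast
      then obtain j where "j \<ge> n k" "v j \<noteq> z j" by auto
      moreover have "n k \<ge> q"
        using strict_mono_imp_increasing[OF n, of k] by (simp add: k_def)
      ultimately show False by (simp add: v_def)
    qed
    ultimately show ?thesis by (simp add: nowhere_dense_def)
  qed
  moreover have "avoiding n z = \<Union>(range E)"
    unfolding avoiding_def E_def eventually_sequentially by auto
  ultimately show ?thesis
    unfolding meager_def by (intro exI[of _ "range E"]) auto
qed

text \<open>
  A single pattern on \<open>[p, q)\<close> can be made to avoid finitely many nowhere dense sets after
  finitely many initial segments: deal with the pairs one by one, each time extending the pattern
  so far into the complement of the closure of the next set.
\<close>

lemma avoid_finitely_many_nowhere_dense:
  fixes Q :: "(cantor \<times> cantor set) set"
  assumes "finite Q" "\<And>t N. (t, N) \<in> Q \<Longrightarrow> nowhere_dense N"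
  shows "\<exists>q s. \<forall>t N x. (t, N) \<in> Q \<longrightarrow> (\<forall>j<p. x j = t j) \<longrightarrow>
    (\<forall>j\<in>{p..<q}. x j = s j) \<longrightarrow> x \<notin> N"
  using assms
proof (induction rule: finite_induct)
  case empty
  then show ?case by simp
next
  case (insert tN Q)
  obtain t N where tN: "tN = (t, N)" by fastforce
  have "\<exists>q s. \<forall>t N x. (t, N) \<in> Q \<longrightarrow> (\<forall>j<p. x j = t j) \<longrightarrow>
      (\<forall>j\<in>{p..<q}. x j = s j) \<longrightarrow> x \<notin> N"
    by (rule insert.IH) (use insert.prems in blast)
  then obtain q s where IH: "\<forall>t N x. (t, N) \<in> Q \<longrightarrow> (\<forall>j<p. x j = t j) \<longrightarrow>
      (\<forall>j\<in>{p..<q}. x j = s j) \<longrightarrow> x \<notin> N"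
    by (elim exE)
  define v where "v j = (if j < p then t j else s j)" for j
  define C where "C = {x :: cantor. \<forall>j\<in>{0..<max p q}. x j = v j}"
  have "interior (closure N) = {}"
    using insert.prems tN by (auto simp: nowhere_dense_def)
  moreover have "open C" "v \<in> C"
    unfolding C_def using open_cylinder by auto
  ultimately have "\<not> C \<subseteq> closure N"
    using interior_maximal by blast
  then obtain u where u: "u \<in> C" "u \<in> - closure N" by blast
  obtain r where r: "\<And>x. (\<And>j. j < r \<Longrightarrow> x j = u j) \<Longrightarrow> x \<in> - closure N"
    using open_contains_cylinder[OF _ u(2)] by (metis closed_closure open_Compl)
  have us: "u j = s j" if "j \<in> {p..<q}" for j
    using u(1) that by (auto simp: C_def v_def)
  have ut: "u j = t j" if "j < p" for j
    using u(1) that by (auto simp: C_def v_def)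
  have "x \<notin> M" if "(t', M) \<in> insert tN Q" "\<forall>j<p. x j = t' j" "\<forall>j\<in>{p..<max q r}. x j = u j"
    for t' M x
  proof (cases "(t', M) \<in> Q")
    case True
    moreover have "\<forall>j\<in>{p..<q}. x j = s j" using that(3) us by auto
    ultimately show ?thesis using IH that(2) by blast
  next
    case False
    then have [simp]: "t' = t" "M = N" using that(1) tN by auto
    have "x j = u j" if "j < r" for j
      using that \<open>\<forall>j<p. x j = t' j\<close> \<open>\<forall>j\<in>{p..<max q r}. x j = u j\<close> ut by (cases "j < p") auto
    then show ?thesis using r[of x] closure_subset[of N] by auto
  qed
  then show ?case by (intro exI[of _ "max q r"] exI[of _ u]) blast
qed

text \<open>
  There are only finitely many initial segments of length \<open>p\<close>, so they can all be treated together.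
\<close>

lemma avoid_finitely_many_nowhere_dense_everywhere:
  fixes \<N> :: "cantor set set"
  assumes "finite \<N>" "\<And>N. N \<in> \<N> \<Longrightarrow> nowhere_dense N"
  obtains q s where "\<And>x. (\<And>j. j \<in> {p..<q} \<Longrightarrow> x j = s j) \<Longrightarrow> x \<notin> \<Union>\<N>"
proof -
  define T where "T = {t :: cantor. \<forall>j. (j \<in> {..<p} \<longrightarrow> t j \<in> UNIV) \<and> (j \<notin> {..<p} \<longrightarrow> t j = 0)}"
  have "finite (UNIV :: bit set)"
    by (rule finite_subset[of _ "{0, 1}"]) (auto intro: bit.exhaust)
  then have "finite T"
    unfolding T_def by (intro finite_set_of_finite_funs) auto
  then have "\<exists>q s. \<forall>t N x. (t, N) \<in> T \<times> \<N> \<longrightarrow> (\<forall>j<p. x j = t j) \<longrightarrow>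
      (\<forall>j\<in>{p..<q}. x j = s j) \<longrightarrow> x \<notin> N"
    by (intro avoid_finitely_many_nowhere_dense) (use assms in auto)
  then obtain q s where qs: "\<forall>t N x. (t, N) \<in> T \<times> \<N> \<longrightarrow> (\<forall>j<p. x j = t j) \<longrightarrow>
      (\<forall>j\<in>{p..<q}. x j = s j) \<longrightarrow> x \<notin> N"
    by (elim exE)
  have "x \<notin> \<Union>\<N>" if "\<And>j. j \<in> {p..<q} \<Longrightarrow> x j = s j" for x
  proof -
    have "(\<lambda>j. if j < p then x j else 0) \<in> T" by (simp add: T_def)
    moreover have "\<forall>j<p. x j = (if j < p then x j else 0)" by simp
    ultimately show ?thesis using qs that by blast
  qed
  then show thesis using that by blast
qed

text \<open>
  Cofinality of the sets \<^const>\<open>avoiding\<close>: on the \<open>k\<close>-th block, \<open>z\<close> is a pattern that forces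
  a point out of the sets with index at most \<open>k\<close> of a cover by nowhere dense sets.  A covered
  point can then match \<open>z\<close> on only finitely many blocks.  Lengthening a pattern does no harm,
  which is why the blocks can be chosen to end at values of \<open>n\<close>.
\<close>

lemma meager_subset_avoiding:
  fixes M :: "cantor set" and n :: "nat \<Rightarrow> nat"
  assumes M: "meager M" and n: "strict_mono n"
  obtains i z where "strict_mono i" "M \<subseteq> avoiding (n \<circ> i) z"
proof -
  obtain F where F: "countable F" "\<forall>N\<in>F. nowhere_dense N" "M = \<Union>F"
    using M unfolding meager_def by blast
  \<comment> \<open>The empty set is added because an enumeration exists only for a nonempty family.\<close>
  define N where "N = from_nat_into (insert {} F)"
  have range_N: "range N = insert {} F"
    unfolding N_def using F(1) by (intro range_from_nat_into) auto
  then have nd: "nowhere_dense (N m)" for m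
    using F(2) rangeI[of N m] by (auto simp: nowhere_dense_def)
  \<comment> \<open>A pair consists of the index at which a block ends and the pattern used on that block.\<close>
  define forces where "forces k b b' \<longleftrightarrow> fst b < fst b' \<and>
      (\<forall>x. (\<forall>j\<in>{n (fst b)..<n (fst b')}. x j = snd b' j) \<longrightarrow> x \<notin> \<Union>(N ` {..k}))"
    for k and b b' :: "nat \<times> cantor"
  have "\<exists>b'. forces k b b'" for b :: "nat \<times> cantor" and k
  proof -
    obtain q s where
      qs: "\<And>x. (\<And>j. j \<in> {n (fst b)..<q} \<Longrightarrow> x j = s j) \<Longrightarrow> x \<notin> \<Union>(N ` {..k})"
      using avoid_finitely_many_nowhere_dense_everywhere[of "N ` {..k}" "n (fst b)"] nd by blast
    have "q \<le> n (max q (Suc (fst b)))"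
      using strict_mono_imp_increasing[OF n, of "max q (Suc (fst b))"] by simp
    then show ?thesis unfolding forces_def
      by (intro exI[of _ "(max q (Suc (fst b)), s)"] conjI allI impI qs) auto
  qed
  then have "\<exists>f. \<forall>k. True \<and> forces k (f k) (f (Suc k))"
    by (intro dependent_nat_choice) auto
  then obtain f where forces: "\<And>k. forces k (f k) (f (Suc k))"
    by blast
  have f: "fst (f k) < fst (f (Suc k))"
    "\<forall>j\<in>{n (fst (f k))..<n (fst (f (Suc k)))}. x j = snd (f (Suc k)) j \<Longrightarrow>
      x \<notin> \<Union>(N ` {..k})" for k x
    using forces[of k] unfolding forces_def by blast+
  define i where "i k = fst (f k)" for k
  have i: "strict_mono i"
    unfolding i_def strict_mono_Suc_iff using f(1) by blast
  then have ni: "strict_mono (n \<circ> i)"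
    using n by (simp add: strict_mono_o)
  \<comment> \<open>The least \<open>k\<close> here is the index of the right end of the block that contains \<open>j\<close>.\<close>
  define z where "z j = snd (f (LEAST k. j < n (i k))) j" for j
  have z: "z j = snd (f (Suc k)) j" if j: "j \<in> {n (i k)..<n (i (Suc k))}" for j k
  proof -
    have "(LEAST k. j < n (i k)) = Suc k"
    proof (rule Least_equality)
      fix k' assume "j < n (i k')"
      then have "(n \<circ> i) k < (n \<circ> i) k'" using j by simp
      then show "Suc k \<le> k'" using ni strict_mono_less by fastforce
    qed (use j in simp)
    then show ?thesis by (simp add: z_def)
  qed
  have "x \<in> avoiding (n \<circ> i) z" if "x \<in> M" for x
  proof -
    obtain m where m: "x \<in> N m"
      using \<open>x \<in> M\<close> F(3) range_N by (metis UnionE image_iff insertCI)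
    have "\<exists>j\<in>{n (i k)..<n (i (Suc k))}. x j \<noteq> z j" if "k \<ge> m" for k
    proof (rule ccontr)
      assume "\<not> ?thesis"
      then have "x \<notin> \<Union>(N ` {..k})"
        using f(2)[of k x] z[of _ k] by (simp add: i_def)
      then show False using m that by auto
    qed
    then show ?thesis
      unfolding avoiding_def eventually_sequentially by auto
  qed
  with i that show thesis by blast
qed

section \<open>Sums with sets of points avoiding a pattern\<close>

lemma restrict_eq_iff: "restrict x A = restrict y A \<longleftrightarrow> (\<forall>j\<in>A. x j = y j)"
  by (auto simp: restrict_def fun_eq_iff)

lemma plus_mem_avoiding:
  fixes x y :: cantor
  assumes n: "strict_mono n" and a: "a \<in> avoiding n z" and i: "strict_mono i"
    and match: "\<forall>\<^sub>F k in sequentially. \<exists>l\<in>{i k..<i (Suc k)}. \<forall>j\<in>{n l..<n (Suc l)}. x j = y j"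
  shows "x + a \<in> avoiding (n \<circ> i) (y + z)"
proof -
  have "\<forall>\<^sub>F l in sequentially. \<exists>j\<in>{n l..<n (Suc l)}. a j \<noteq> z j"
    using a by (simp add: avoiding_def)
  then obtain m where m: "\<And>l. l \<ge> m \<Longrightarrow> \<exists>j\<in>{n l..<n (Suc l)}. a j \<noteq> z j"
    unfolding eventually_sequentially by blast
  have "\<forall>\<^sub>F k in sequentially. \<exists>j\<in>{n (i k)..<n (i (Suc k))}. (x + a) j \<noteq> (y + z) j"
    using match eventually_ge_at_top[of m]
  proof eventually_elim
    case (elim k)
    then obtain l where l: "i k \<le> l" "Suc l \<le> i (Suc k)" "\<forall>j\<in>{n l..<n (Suc l)}. x j = y j"
      by auto
    then have "l \<ge> m"
      using elim strict_mono_imp_increasing[OF i, of k] by linarith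
    then obtain j where j: "j \<in> {n l..<n (Suc l)}" "a j \<noteq> z j"
      using m by blast
    then have "(x + a) j \<noteq> (y + z) j"
      using l(3) by (metis add_left_cancel plus_fun_apply)
    moreover have "n (i k) \<le> n l" "n (Suc l) \<le> n (i (Suc k))"
      using l by (auto intro: strict_mono_leD[OF n])
    ultimately show ?case
      using j(1) by (intro bexI[of _ j]) auto
  qed
  then show ?thesis by (simp add: avoiding_def)
qed

text \<open>
  Otherwise \<open>z - x\<close> is nonzero on each small block inside infinitely many coarse ones.  Its
  restriction to these coarse blocks, continued by \<open>1\<close>, is a point whose translate by \<open>x\<close> is
  equal to \<open>z\<close> on all of them.
\<close>

lemma match_if_translate_avoiding:
  fixes x z :: cantor
  assumes n: "strict_mono n" and sub: "\<And>a. a \<in> avoiding n 0 \<Longrightarrow> x + a \<in> avoiding (n \<circ> i) z"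
  shows "\<forall>\<^sub>F k in sequentially. \<exists>l\<in>{i k..<i (Suc k)}. \<forall>j\<in>{n l..<n (Suc l)}. x j = z j"
proof -
  define B where "B = {k. \<forall>l\<in>{i k..<i (Suc k)}. \<exists>j\<in>{n l..<n (Suc l)}. x j \<noteq> z j}"
  define a where
    "a j = (if \<exists>k\<in>B. j \<in> {n (i k)..<n (i (Suc k))} then z j - x j else 1)" for j
  have "\<exists>j\<in>{n l..<n (Suc l)}. a j \<noteq> 0" for l
  proof (cases "\<exists>k\<in>B. l \<in> {i k..<i (Suc k)}")
    case True
    then obtain k where k: "k \<in> B" "i k \<le> l" "Suc l \<le> i (Suc k)" by auto
    then have "l \<in> {i k..<i (Suc k)}" by simp
    then obtain j where j: "j \<in> {n l..<n (Suc l)}" "x j \<noteq> z j"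
      using k(1) unfolding B_def by blast
    have "n (i k) \<le> n l" "n (Suc l) \<le> n (i (Suc k))"
      using k by (auto intro: strict_mono_leD[OF n])
    then have "a j = z j - x j"
      using j(1) k(1) unfolding a_def by (auto simp del: minus_bit_def)
    then have "a j \<noteq> 0"
      using j(2) by (metis right_minus_eq)
    then show ?thesis using j(1) by blast
  next
    case False
    then have "a (n l) = 1"
      using n by (auto simp: a_def strict_mono_less_eq strict_mono_less)
    then show ?thesis
      using n by (intro bexI[of _ "n l"]) (auto simp: strict_mono_less)
  qed
  then have "a \<in> avoiding n 0"
    by (simp add: avoiding_def)
  then have "\<forall>\<^sub>F k in sequentially. \<exists>j\<in>{n (i k)..<n (i (Suc k))}. (x + a) j \<noteq> z j"
    using sub by (simp add: avoiding_def)
  then show ?thesis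
  proof eventually_elim
    case (elim k)
    have "(x + a) j = z j" if "k \<in> B" "j \<in> {n (i k)..<n (i (Suc k))}" for j
    proof -
      have "a j = z j - x j" using that by (auto simp: a_def)
      then show ?thesis by (metis add_diff_cancel_left' diff_add_cancel add.commute plus_fun_apply)
    qed
    with elim have "k \<notin> B" by blast
    then show ?case unfolding B_def by blast
  qed
qed

theorem theorem18:
  fixes X :: "cantor set"
  shows "meager_additive X \<longleftrightarrow>
    (\<forall>n :: nat \<Rightarrow> nat. strict_mono n \<longrightarrow>
      (\<exists>(i :: nat \<Rightarrow> nat) (y :: cantor). strict_mono i \<and>
        (\<forall>x\<in>X. \<forall>\<^sub>F k in sequentially. \<exists>l\<in>{i k..<i (Suc k)}.
          restrict x {n l..<n (Suc l)} = restrict y {n l..<n (Suc l)})))"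
  unfolding restrict_eq_iff
proof (intro iffI allI impI)
  fix n :: "nat \<Rightarrow> nat"
  assume X: "meager_additive X" and n: "strict_mono n"
  then have "meager (X + avoiding n 0)"
    using meager_avoiding unfolding meager_additive_def by blast
  then obtain i z where i: "strict_mono i" "X + avoiding n 0 \<subseteq> avoiding (n \<circ> i) z"
    using meager_subset_avoiding n by blast
  then have "x + a \<in> avoiding (n \<circ> i) z" if "x \<in> X" "a \<in> avoiding n 0" for x a
    using that by (blast intro: set_plus_intro)
  then show "\<exists>i y. strict_mono i \<and> (\<forall>x\<in>X. \<forall>\<^sub>F k in sequentially.
      \<exists>l\<in>{i k..<i (Suc k)}. \<forall>j\<in>{n l..<n (Suc l)}. x j = y j)"
    using i(1) match_if_translate_avoiding[OF n] by blast
next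
  assume *: "\<forall>n :: nat \<Rightarrow> nat. strict_mono n \<longrightarrow> (\<exists>(i :: nat \<Rightarrow> nat) y. strict_mono i \<and>
    (\<forall>x\<in>X. \<forall>\<^sub>F k in sequentially. \<exists>l\<in>{i k..<i (Suc k)}. \<forall>j\<in>{n l..<n (Suc l)}. x j = y j))"
  show "meager_additive X"
    unfolding meager_additive_def
  proof (intro allI impI)
    fix A :: "cantor set" assume "meager A"
    then obtain n z where n: "strict_mono n" "A \<subseteq> avoiding n z"
      using meager_subset_avoiding[of A id] by (auto simp: strict_mono_def)
    then obtain i y where i: "strict_mono i" "\<forall>x\<in>X. \<forall>\<^sub>F k in sequentially.
        \<exists>l\<in>{i k..<i (Suc k)}. \<forall>j\<in>{n l..<n (Suc l)}. x j = y j"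
      using * by blast
    then have "X + A \<subseteq> avoiding (n \<circ> i) (y + z)"
      using n plus_mem_avoiding by (auto elim!: set_plus_elim)
    then show "meager (X + A)"
      using meager_subset meager_avoiding strict_mono_o n(1) i(1) by blast
  qed
qed

end
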